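(* Let $\mathcal{C}\subseteq\mathbb{Z}_2^\alpha\times R^\beta$ be a $\mathbb{Z}_2R$ linear code such that $4\mid N_{1,1}(\mathbf w,\mathbf y)$ for any two codewords $(\mathbf v|\mathbf w),(\mathbf x|\mathbf y)\in\mathcal{C}$. If $\mathcal{C}$ is self-orthogonal, then $\theta(\mathcal{C})$ is also a self-orthogonal code over $\mathbb{Z}_2\mathbb{Z}_4$. Furthermore, if $\mathcal{C}$ is self-dual, then $\theta(\mathcal{C})$ is also a self-dual code over $\mathbb{Z}_2\mathbb{Z}_4$.
   Context: Let $R=\mathbb{Z}_2+u\mathbb{Z}_2=\{0,1,u,1+u\}$ with $u^2=0$, and $\eta:R\to\mathbb{Z}_2$, $\eta(r+uq)=r$. The set $\mathbb{Z}_2^\alpha\times R^\beta$ is an $R$-module under $d(a_1,\dots,a_\alpha\mid b_1,\dots,b_\beta)=(\eta(d)a_1,\dots,\eta(d)a_\alpha\mid db_1,\dots,db_\beta)$. A $\mathbb{Z}_2R$ linear code is an $R$-submodule $\mathcal{C}$ of $\mathbb{Z}_2^\alpha\times R^\beta$. The inner product is $\langle(\mathbf v|\mathbf w),(\mathbf x|\mathbf y)\rangle=u\sum_{i=1}^\alpha v_ix_i+\sum_{j=1}^\beta w_jy_j\in R$. On $\mathbb{Z}_2^\alpha\times\mathbb{Z}_4^\beta$ the inner product is $\langle(\mathbf v|\mathbf w),(\mathbf x|\mathbf y)\rangle=2\sum_{i=1}^\alpha v_ix_i+\sum_{j=1}^\beta w_jy_j\in\mathbb{Z}_4$. In both settings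 $\mathcal{C}^\perp$ is the set of vectors orthogonal to all of $\mathcal{C}$; $\mathcal{C}$ is self-orthogonal if $\mathcal{C}\subseteq\mathcal{C}^\perp$ and self-dual if $\mathcal{C}=\mathcal{C}^\perp$. The map $\theta:\mathbb{Z}_2^\alpha\times R^\beta\to\mathbb{Z}_2^\alpha\times\mathbb{Z}_4^\beta$ is $\theta(\mathbf v|\mathbf w)=(\mathbf v|\theta(w_1),\dots,\theta(w_\beta))$ with $\theta(0)=0$, $\theta(1)=1$, $\theta(u)=2$, $\theta(1+u)=3$. For $\mathbf w,\mathbf y\in R^\beta$, $N_{1,1}(\mathbf w,\mathbf y)$ is the number of indices $i$ such that both $w_i$ and $y_i$ are units (i.e. in $\{1,1+u\}$). *)

theory Defs
  imports "HOL-Library.Z2" "HOL-Library.Numeral_Type" "Jordan_Normal_Form.Matrix"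
begin

text \<open>\<open>Z2u r q\<close> stands for $r + uq$ in $R = Z_2 + uZ_2$, where $u^2 = 0$; the first
  selector is the reduction map from \<open>R\<close> to the field \<open>bit\<close>.\<close>

datatype z2u = Z2u (eta: bit) (u_part: bit)

instantiation z2u :: comm_ring_1
begin

definition zero_z2u :: z2u where "0 = Z2u 0 0"
definition one_z2u :: z2u where "1 = Z2u 1 0"
definition plus_z2u :: "z2u \<Rightarrow> z2u \<Rightarrow> z2u"
  where "x + y = Z2u (eta x + eta y) (u_part x + u_part y)"
definition uminus_z2u :: "z2u \<Rightarrow> z2u"
  where "- x = Z2u (- eta x) (- u_part x)"
definition minus_z2u :: "z2u \<Rightarrow> z2u \<Rightarrow> z2u"
  where "x - y = Z2u (eta x - eta y) (u_part x - u_part y)"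
definition times_z2u :: "z2u \<Rightarrow> z2u \<Rightarrow> z2u"
  where "x * y = Z2u (eta x * eta y) (eta x * u_part y + u_part x * eta y)"

lemmas z2u_defs = zero_z2u_def one_z2u_def plus_z2u_def uminus_z2u_def minus_z2u_def times_z2u_def

instance
  by standard
    (simp_all only: z2u_defs z2u.sel z2u.inject z2u.expand algebra_simps z2u.collapse
      add_0_left add_0_right mult_1_left mult_1_right mult_zero_left mult_zero_right
      left_minus right_minus simp_thms zero_neq_one)

end

definition u :: z2u where "u = Z2u 0 1"

lemma z2u_cases: "x = 0 \<or> x = 1 \<or> x = u \<or> x = 1 + u"
  by (cases x; cases "eta x"; cases "u_part x") (auto simp: z2u_defs u_def)

lemma u_square: "u * u = 0"
  by (simp add: u_def z2u_defs)

lemma Z2u_eq: "Z2u r q = of_bit r + u * of_bit q"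
  by (cases r; cases q) (simp_all add: u_def z2u_defs)

lemma eta_hom: "eta (x + y) = eta x + eta y" "eta (x * y) = eta x * eta y" "eta 1 = 1"
  by (simp_all only: z2u_defs z2u.sel)

lemma z2u_unit_iff: "x dvd 1 \<longleftrightarrow> x \<in> {1, 1 + u}"
proof
  assume "x dvd 1"
  then obtain k where "1 = x * k" ..
  then have "eta x * eta k = 1"
    by (metis eta_hom(2,3))
  then have "eta x \<noteq> 0"
    by (metis mult_zero_left zero_neq_one)
  moreover have "eta 0 = 0" "eta u = 0"
    by (simp_all add: zero_z2u_def u_def)
  ultimately show "x \<in> {1, 1 + u}"
    using z2u_cases[of x] by (metis insert_iff)
next
  have "1 = (1 + u) * (1 + u)"
    by (simp add: u_def z2u_defs)
  then have "1 + u dvd 1"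
    by (rule dvdI)
  moreover assume "x \<in> {1, 1 + u}"
  ultimately show "x dvd 1"
    using dvd_refl by blast
qed

text \<open>\<open>R\<close> and the mixed space as the records used by \<open>HOL-Algebra\<close>; the fields
  \<open>mult\<close> and \<open>one\<close> of the latter are not used in modules.\<close>

definition z2u_ring :: "z2u ring" where
  "z2u_ring = \<lparr>carrier = UNIV, mult = (*), one = 1, zero = 0, add = (+)\<rparr>"

definition Z2R_module :: "nat \<Rightarrow> nat \<Rightarrow> (z2u, bit vec \<times> z2u vec) module" where
  "Z2R_module \<alpha> \<beta> =
    \<lparr>carrier = carrier_vec \<alpha> \<times> carrier_vec \<beta>,
     mult = undefined, one = undefined,
     zero = (0\<^sub>v \<alpha>, 0\<^sub>v \<beta>),
     add = (\<lambda>(a, b) (a', b'). (a + a', b + b')),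
     smult = (\<lambda>d (a, b). (eta d \<cdot>\<^sub>v a, d \<cdot>\<^sub>v b))\<rparr>"

lemma cring_z2u_ring: "cring z2u_ring"
proof (rule cringI)
  show "abelian_group z2u_ring"
  proof (rule abelian_groupI)
    fix x assume "x \<in> carrier z2u_ring"
    show "\<exists>y\<in>carrier z2u_ring. y \<oplus>\<^bsub>z2u_ring\<^esub> x = \<zero>\<^bsub>z2u_ring\<^esub>"
      by (intro bexI[of _ "- x"]) (simp_all add: z2u_ring_def)
  qed (simp_all add: z2u_ring_def ac_simps)
  show "comm_monoid z2u_ring"
    by (rule comm_monoidI) (simp_all add: z2u_ring_def ac_simps)
qed (simp add: z2u_ring_def distrib_right)

lemma module_Z2R: "module z2u_ring (Z2R_module \<alpha> \<beta>)"
proof (rule moduleI)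
  show "cring z2u_ring" by (rule cring_z2u_ring)
  show "abelian_group (Z2R_module \<alpha> \<beta>)"
  proof (rule abelian_groupI)
    fix x assume "x \<in> carrier (Z2R_module \<alpha> \<beta>)"
    then obtain a b where x: "x = (a, b)" "a \<in> carrier_vec \<alpha>" "b \<in> carrier_vec \<beta>"
      by (auto simp: Z2R_module_def)
    then have "- a + a = 0\<^sub>v \<alpha>" "- b + b = 0\<^sub>v \<beta>"
      by (simp_all add: uminus_l_inv_vec del: add_bit_eq_xor uminus_bit_def)
    with x show "\<exists>y\<in>carrier (Z2R_module \<alpha> \<beta>). y \<oplus>\<^bsub>Z2R_module \<alpha> \<beta>\<^esub> x = \<zero>\<^bsub>Z2R_module \<alpha> \<beta>\<^esub>"
      by (intro bexI[of _ "(- a, - b)"]) (simp_all add: Z2R_module_def)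
  qed (auto simp: Z2R_module_def assoc_add_vec intro: comm_add_vec)
qed (auto simp: Z2R_module_def z2u_ring_def eta_hom add_smult_distrib_vec
    smult_add_distrib_vec smult_smult_assoc simp del: add_bit_eq_xor mult_bit_eq_and)

definition Z2R_linear_code :: "nat \<Rightarrow> nat \<Rightarrow> (bit vec \<times> z2u vec) set \<Rightarrow> bool" where
  "Z2R_linear_code \<alpha> \<beta> C \<longleftrightarrow> submodule C z2u_ring (Z2R_module \<alpha> \<beta>)"

text \<open>In both inner products the binary coordinates are lifted to \<open>0\<close> and \<open>1\<close> of the
  target ring; multiplication by $u$ resp. $2$ makes the result depend only on the binary
  sum modulo 2.\<close>

definition Z2R_inner :: "bit vec \<times> z2u vec \<Rightarrow> bit vec \<times> z2u vec \<Rightarrow> z2u" where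
  "Z2R_inner = (\<lambda>(v, w) (x, y). u * (map_vec of_bit v \<bullet> map_vec of_bit x) + w \<bullet> y)"

definition Z2Z4_inner :: "bit vec \<times> 4 vec \<Rightarrow> bit vec \<times> 4 vec \<Rightarrow> 4" where
  "Z2Z4_inner = (\<lambda>(v, w) (x, y). 2 * (map_vec of_bit v \<bullet> map_vec of_bit x) + w \<bullet> y)"

definition Z2R_dual :: "nat \<Rightarrow> nat \<Rightarrow> (bit vec \<times> z2u vec) set \<Rightarrow> (bit vec \<times> z2u vec) set" where
  "Z2R_dual \<alpha> \<beta> C = {p \<in> carrier_vec \<alpha> \<times> carrier_vec \<beta>. \<forall>c\<in>C. Z2R_inner c p = 0}"

definition Z2Z4_dual :: "nat \<Rightarrow> nat \<Rightarrow> (bit vec \<times> 4 vec) set \<Rightarrow> (bit vec \<times> 4 vec) set" where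
  "Z2Z4_dual \<alpha> \<beta> C = {p \<in> carrier_vec \<alpha> \<times> carrier_vec \<beta>. \<forall>c\<in>C. Z2Z4_inner c p = 0}"

definition Z2R_self_orthogonal :: "nat \<Rightarrow> nat \<Rightarrow> (bit vec \<times> z2u vec) set \<Rightarrow> bool" where
  "Z2R_self_orthogonal \<alpha> \<beta> C \<longleftrightarrow> C \<subseteq> Z2R_dual \<alpha> \<beta> C"

definition Z2R_self_dual :: "nat \<Rightarrow> nat \<Rightarrow> (bit vec \<times> z2u vec) set \<Rightarrow> bool" where
  "Z2R_self_dual \<alpha> \<beta> C \<longleftrightarrow> C = Z2R_dual \<alpha> \<beta> C"

text \<open>The codes over $Z_2 Z_4$ below are arbitrary subsets: the image of a linear code under
  \<open>theta\<close> need not be additive. A self-dual one is additive automatically, as a dual.\<close>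

definition Z2Z4_self_orthogonal :: "nat \<Rightarrow> nat \<Rightarrow> (bit vec \<times> 4 vec) set \<Rightarrow> bool" where
  "Z2Z4_self_orthogonal \<alpha> \<beta> C \<longleftrightarrow> C \<subseteq> Z2Z4_dual \<alpha> \<beta> C"

definition Z2Z4_self_dual :: "nat \<Rightarrow> nat \<Rightarrow> (bit vec \<times> 4 vec) set \<Rightarrow> bool" where
  "Z2Z4_self_dual \<alpha> \<beta> C \<longleftrightarrow> C = Z2Z4_dual \<alpha> \<beta> C"

definition theta_elem :: "z2u \<Rightarrow> 4" where
  "theta_elem x = (if x = 0 then 0 else if x = 1 then 1 else if x = u then 2 else 3)"

lemma theta_elem_values:
  "theta_elem 0 = 0" "theta_elem 1 = 1" "theta_elem u = 2" "theta_elem (1 + u) = 3"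
  by (simp_all add: theta_elem_def u_def z2u_defs)

definition theta :: "bit vec \<times> z2u vec \<Rightarrow> bit vec \<times> 4 vec" where
  "theta = (\<lambda>(v, w). (v, map_vec theta_elem w))"

definition N11 :: "z2u vec \<Rightarrow> z2u vec \<Rightarrow> nat" where
  "N11 w y = card {i. i < dim_vec w \<and> w $ i dvd 1 \<and> y $ i dvd 1}"

end

theory Submission
  imports Defs
begin

text \<open>The inner product of $\theta(c)$ and $\theta(p)$ is $N_{1,1} + 2\mu$, where $\mu$ is the
  $u$-part of the inner product of $c$ and $p$ over $R$, and $N_{1,1}$ mod 2 is its residue part.
  So both inner products vanish together when $4 \mid N_{1,1}$, which settles self-orthogonality.

  For self-duality let $\theta(x|y)$ be orthogonal to $\theta(C)$. The functional $\mu$ on $C$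
  vanishes on all codewords $(v|w)$ with $\eta(w) = 0$, hence $\mu(v|w) = \sum_i z_i \eta(w_i)$ for
  some $z$. Then $(x|y+uz)$ is orthogonal to $C$ and so lies in $C = C^\perp$. Since
  $N_{1,1}$ only depends on residues, $4 \mid N_{1,1}(w, y)$ for every codeword $(v|w)$, and
  therefore $(x|y)$ itself lies in $C^\perp = C$.\<close>

section \<open>Functionals over the field with two elements\<close>

text \<open>The standard fact that a functional vanishing on the common kernel of finitely many
  others is a linear combination of them; over \<open>bit\<close> additivity is all of linearity.
  The operation \<open>f\<close> is abstract so that \<open>S\<close> can be a code of pairs of
  vectors. The induction removes the last functional by adding a suitable multiple of it to
  \<open>g\<close>.\<close>

lemma bit_functional_in_span:
  fixes e :: "nat \<Rightarrow> 'a \<Rightarrow> bit" and g :: "'a \<Rightarrow> bit"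
  assumes closed: "\<And>s t. s \<in> S \<Longrightarrow> t \<in> S \<Longrightarrow> f s t \<in> S"
    and e_add: "\<And>i s t. i < n \<Longrightarrow> s \<in> S \<Longrightarrow> t \<in> S \<Longrightarrow> e i (f s t) = e i s + e i t"
    and g_add: "\<And>s t. s \<in> S \<Longrightarrow> t \<in> S \<Longrightarrow> g (f s t) = g s + g t"
    and g_zero: "\<And>s. s \<in> S \<Longrightarrow> (\<And>i. i < n \<Longrightarrow> e i s = 0) \<Longrightarrow> g s = 0"
  shows "\<exists>z. \<forall>s\<in>S. g s = (\<Sum>i<n. z i * e i s)"
  using e_add g_add g_zero
proof (induction n arbitrary: g)
  case 0
  then show ?case by simp
next
  case (Suc n)
  \<comment> \<open>On the common kernel of the first \<open>n\<close> functionals,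
    \<open>g s = 1\<close> forces \<open>e n s = 1\<close>. The coefficient \<open>b\<close> is
    chosen so that \<open>g\<close> agrees there with \<open>b * e n\<close>.\<close>
  define b :: bit where "b = of_bool (\<exists>s\<in>S. (\<forall>i<n. e i s = 0) \<and> g s = 1)"
  define h where "h s = g s + b * e n s" for s
  have "\<exists>z. \<forall>s\<in>S. h s = (\<Sum>i<n. z i * e i s)"
  proof (rule Suc.IH)
    show "e i (f s t) = e i s + e i t" if "i < n" "s \<in> S" "t \<in> S" for i s t
      using that Suc.prems(1) less_SucI by blast
    show "h (f s t) = h s + h t" if "s \<in> S" "t \<in> S" for s t
      unfolding h_def using that Suc.prems(1)[of n s t] Suc.prems(2)[of s t]
      by (simp add: algebra_simps del: add_bit_eq_xor mult_bit_eq_and)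
    show "h s = 0" if s: "s \<in> S" and s0: "\<And>i. i < n \<Longrightarrow> e i s = 0" for s
    proof (cases "e n s = 0")
      case True
      then have "g s = 0"
        using s s0 Suc.prems(3) less_Suc_eq by metis
      with True show ?thesis by (simp add: h_def)
    next
      case False
      then have s1: "e n s = 1" by simp
      show ?thesis
      proof (cases "\<exists>t\<in>S. (\<forall>i<n. e i t = 0) \<and> g t = 1")
        case True
        then obtain t where t: "t \<in> S" "\<And>i. i < n \<Longrightarrow> e i t = 0" "g t = 1" by blast
        have t1: "e n t = 1"
          using t Suc.prems(3)[of t] less_Suc_eq by (metis bit_not_zero_iff zero_neq_one)
        \<comment> \<open>Both \<open>s\<close> and \<open>t\<close> have \<open>e n\<close> equal
          to 1, so their sum lies in the kernel of \<open>e n\<close> as well, and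
          \<open>g s = g t\<close> follows.\<close>
        have "g (f s t) = 0"
        proof (rule Suc.prems(3))
          show "f s t \<in> S" using s t(1) by (rule closed)
          show "e i (f s t) = 0" if "i < Suc n" for i
            using that Suc.prems(1)[OF that s t(1)] s0 t(2) s1 t1 by (cases "i = n") auto
        qed
        then have "g s = 1"
          using Suc.prems(2)[OF s t(1)] t(3) by (cases "g s") auto
        with True s1 show ?thesis by (simp add: h_def b_def)
      next
        case no: False
        then have "g s = 0" using s s0 by (cases "g s") auto
        with no show ?thesis by (simp add: h_def b_def)
      qed
    qed
  qed
  then obtain z where z: "\<And>s. s \<in> S \<Longrightarrow> h s = (\<Sum>i<n. z i * e i s)" by blast
  \<comment> \<open>In characteristic 2, adding the same term a second time undoes the first
    addition.\<close>
  have g_h: "g s = h s + b * e n s" for s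
    by (cases "g s"; cases "b * e n s") (auto simp: h_def)
  have "g s = (\<Sum>i<Suc n. (z(n := b)) i * e i s)" if "s \<in> S" for s
  proof -
    have "(\<Sum>i<n. (z(n := b)) i * e i s) = h s"
      unfolding z[OF that] by (intro sum.cong) auto
    then show ?thesis
      by (simp only: sum.lessThan_Suc g_h fun_upd_same)
  qed
  then show ?case by blast
qed

section \<open>Residue and \<open>u\<close>-part of the inner product over \<open>R\<close>\<close>

lemma eta_sum: "eta (sum h A) = (\<Sum>i\<in>A. eta (h i))"
  by (induction A rule: infinite_finite_induct) (simp_all only: sum.infinite sum.empty sum.insert
      eta_hom zero_z2u_def z2u.sel not_False_eq_True)

lemma u_part_add: "u_part (x + y) = u_part x + u_part y"
  by (simp only: plus_z2u_def z2u.sel)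

lemma u_part_sum: "u_part (sum h A) = (\<Sum>i\<in>A. u_part (h i))"
  by (induction A rule: infinite_finite_induct) (simp_all only: sum.infinite sum.empty sum.insert
      u_part_add zero_z2u_def z2u.sel not_False_eq_True)

lemma u_part_mult: "u_part (x * y) = eta x * u_part y + u_part x * eta y"
  by (simp only: times_z2u_def z2u.sel)

lemma eta_u_mult: "eta (u * x) = 0" "u_part (u * x) = eta x"
  by (simp_all add: u_def times_z2u_def)

lemma eta_of_bit: "eta (of_bit b) = b"
  by (cases b) (simp_all add: z2u_defs)

lemma z2u_unit_iff_eta: "x dvd 1 \<longleftrightarrow> eta x = 1"
  unfolding z2u_unit_iff
  by (cases x; cases "eta x"; cases "u_part x") (auto simp: z2u_defs u_def)

lemma eta_Z2R_inner:
  assumes "w \<in> carrier_vec \<beta>" "y \<in> carrier_vec \<beta>"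
  shows "eta (Z2R_inner (v, w) (x, y)) = (\<Sum>i<\<beta>. eta (w $ i) * eta (y $ i))"
proof -
  have "eta (Z2R_inner (v, w) (x, y)) = eta (\<Sum>i<\<beta>. w $ i * y $ i)"
    using assms by (simp only: Z2R_inner_def case_prod_conv eta_hom(1) eta_u_mult add_0_left
        scalar_prod_def carrier_vecD atLeast0LessThan)
  then show ?thesis by (simp only: eta_sum eta_hom(2))
qed

lemma u_part_Z2R_inner:
  assumes "v \<in> carrier_vec \<alpha>" "x \<in> carrier_vec \<alpha>" "w \<in> carrier_vec \<beta>" "y \<in> carrier_vec \<beta>"
  shows "u_part (Z2R_inner (v, w) (x, y)) =
    (\<Sum>i<\<alpha>. v $ i * x $ i) + (\<Sum>i<\<beta>. u_part (w $ i * y $ i))"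
proof -
  have "map_vec of_bit v \<bullet> map_vec of_bit x = (\<Sum>i<\<alpha>. of_bit (v $ i) * of_bit (x $ i) :: z2u)"
    using assms(1,2) unfolding scalar_prod_def atLeast0LessThan by (intro sum.cong) auto
  moreover have "w \<bullet> y = (\<Sum>i<\<beta>. w $ i * y $ i)"
    using assms(4) by (simp add: scalar_prod_def atLeast0LessThan)
  ultimately show ?thesis
    by (simp only: Z2R_inner_def case_prod_conv u_part_add eta_u_mult eta_sum u_part_sum
        eta_hom(2) eta_of_bit)
qed

text \<open>Units are the elements of residue 1, so the count is a sum of products of residues. The
  target semiring is general because the count is read both in \<open>bit\<close>, as a parity, and
  in \<open>4\<close>.\<close>

lemma of_nat_N11:
  assumes "w \<in> carrier_vec \<beta>"
  shows "of_nat (N11 w y) = (\<Sum>i<\<beta>. of_bit (eta (w $ i) * eta (y $ i)) :: 'a :: comm_semiring_1)"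
proof -
  have "{i. i < dim_vec w \<and> w $ i dvd 1 \<and> y $ i dvd 1} =
    {i \<in> {..<\<beta>}. eta (w $ i) = 1 \<and> eta (y $ i) = 1}"
    using assms by (auto simp: z2u_unit_iff_eta)
  then have "of_nat (N11 w y) =
    (\<Sum>i<\<beta>. if eta (w $ i) = 1 \<and> eta (y $ i) = 1 then 1 else 0 :: 'a)"
    by (simp add: N11_def sum.If_cases Int_def)
  also have "\<dots> = (\<Sum>i<\<beta>. of_bit (eta (w $ i) * eta (y $ i)))"
  proof (rule sum.cong[OF refl])
    fix i
    show "(if eta (w $ i) = 1 \<and> eta (y $ i) = 1 then 1 else 0 :: 'a) =
      of_bit (eta (w $ i) * eta (y $ i))"
      by (cases "eta (w $ i)"; cases "eta (y $ i)") auto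
  qed
  finally show ?thesis .
qed

section \<open>Inner products of images under \<open>theta\<close>\<close>

text \<open>The carry lost in adding bits modulo 2 is a multiple of 2, and doubling turns it into a
  multiple of 4.\<close>

lemma double_of_bit_add: "(2 :: 4) * of_bit (a + b) = 2 * of_bit a + 2 * of_bit b"
  by (cases a; cases b) simp_all

lemma double_of_bit_sum: "(2 :: 4) * of_bit (sum h A) = (\<Sum>i\<in>A. 2 * of_bit (h i))"
  by (induction A rule: infinite_finite_induct)
    (simp_all only: double_of_bit_add sum.infinite sum.empty sum.insert dvd_0_right of_bool_eq
      mult_zero_right not_True_eq_False not_False_eq_True)

text \<open>Since \<open>theta_elem\<close> sends r + uq to r + 2q, the product is rr' + 2(rq' +
  qr') + 4qq', and the last term vanishes.\<close>

lemma theta_elem_mult: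
  "theta_elem x * theta_elem y = of_bit (eta x * eta y) + 2 * of_bit (u_part (x * y))"
  by (cases x; cases y; cases "eta x"; cases "u_part x"; cases "eta y"; cases "u_part y")
    (simp_all add: theta_elem_def z2u_defs u_def)

text \<open>Products of residues are summed in \<open>4\<close> without reduction modulo 2, which is
  why the count itself appears and not its parity. All other terms are doubled, so their bits may be
  summed modulo 2.\<close>

lemma Z2Z4_inner_theta:
  assumes "v \<in> carrier_vec \<alpha>" "x \<in> carrier_vec \<alpha>" "w \<in> carrier_vec \<beta>" "y \<in> carrier_vec \<beta>"
  shows "Z2Z4_inner (theta (v, w)) (theta (x, y)) =
    of_nat (N11 w y) + 2 * of_bit (u_part (Z2R_inner (v, w) (x, y)))"
proof -
  have bits: "2 * (of_bit a * of_bit b :: 4) = 2 * of_bit (a * b)" for a b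
    by (cases a; cases b) simp_all
  have "2 * (map_vec of_bit v \<bullet> map_vec of_bit x :: 4) = (\<Sum>i<\<alpha>. 2 * of_bit (v $ i * x $ i))"
    using assms(1,2) unfolding scalar_prod_def atLeast0LessThan sum_distrib_left
    by (intro sum.cong) (auto simp only: bits index_map_vec carrier_vecD lessThan_iff)
  moreover have "map_vec theta_elem w \<bullet> map_vec theta_elem y =
    (\<Sum>i<\<beta>. theta_elem (w $ i) * theta_elem (y $ i))"
    using assms(3,4) unfolding scalar_prod_def atLeast0LessThan by (intro sum.cong) auto
  ultimately have "Z2Z4_inner (theta (v, w)) (theta (x, y)) =
    (\<Sum>i<\<alpha>. 2 * of_bit (v $ i * x $ i)) + (\<Sum>i<\<beta>. theta_elem (w $ i) * theta_elem (y $ i))"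
    by (simp only: Z2Z4_inner_def theta_def case_prod_conv)
  then show ?thesis
    unfolding u_part_Z2R_inner[OF assms] of_nat_N11[OF assms(3)] double_of_bit_add
      double_of_bit_sum theta_elem_mult sum.distrib by (simp only: ac_simps)
qed

section \<open>Vanishing of the inner products\<close>

lemma four_eq_0: "(4 :: 4) = 0"
  by simp

lemma of_nat_4_eq_0_iff: "(of_nat n :: 4) = 0 \<longleftrightarrow> 4 dvd n"
proof -
  have "(of_nat n :: 4) = of_nat (n mod 4) + 4 * of_nat (n div 4)"
    by (metis mod_mult_div_eq of_nat_add of_nat_mult of_nat_numeral)
  then have "(of_nat n :: 4) = of_nat (n mod 4)"
    by (simp only: four_eq_0 mult_zero_left add_0_right)
  moreover have "n mod 4 < 4" by simp
  then have "n mod 4 \<in> {0, 1, 2, 3}" by auto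
  ultimately show ?thesis by (auto simp: dvd_eq_mod_eq_0)
qed

lemma eta_Z2R_inner_eq_0_iff:
  assumes "w \<in> carrier_vec \<beta>" "y \<in> carrier_vec \<beta>"
  shows "eta (Z2R_inner (v, w) (x, y)) = 0 \<longleftrightarrow> even (N11 w y)"
proof -
  have "eta (Z2R_inner (v, w) (x, y)) = of_nat (N11 w y)"
    unfolding eta_Z2R_inner[OF assms] of_nat_N11[OF assms(1)]
  proof (rule sum.cong[OF refl])
    fix i
    show "eta (w $ i) * eta (y $ i) = of_bit (eta (w $ i) * eta (y $ i))"
      by (cases "eta (w $ i) * eta (y $ i)") simp_all
  qed
  moreover have "(of_nat n :: bit) = 0 \<longleftrightarrow> even n" for n
    by (induction n) auto
  ultimately show ?thesis by simp
qed

text \<open>Divisibility by 4 removes the count in \<open>4\<close> and, through its parity, the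
  residue over \<open>R\<close>; the same \<open>u\<close>-part decides both sides.\<close>

lemma Z2Z4_inner_theta_eq_0_iff:
  assumes "v \<in> carrier_vec \<alpha>" "x \<in> carrier_vec \<alpha>" "w \<in> carrier_vec \<beta>" "y \<in> carrier_vec \<beta>"
    and "4 dvd N11 w y"
  shows "Z2Z4_inner (theta (v, w)) (theta (x, y)) = 0 \<longleftrightarrow> Z2R_inner (v, w) (x, y) = 0"
proof -
  have N: "(of_nat (N11 w y) :: 4) = 0"
    using assms(5) by (simp add: of_nat_4_eq_0_iff)
  have eta: "eta (Z2R_inner (v, w) (x, y)) = 0"
    using assms(5) eta_Z2R_inner_eq_0_iff[OF assms(3,4)] by (meson dvd_trans even_numeral)
  have "(2 :: 4) * of_bit b = 0 \<longleftrightarrow> b = 0" for b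
    by (cases b) simp_all
  then show ?thesis
    unfolding Z2Z4_inner_theta[OF assms(1-4)] N using eta
    by (cases "Z2R_inner (v, w) (x, y)") (simp add: zero_z2u_def)
qed

text \<open>Doubling the inner product removes the \<open>u\<close>-part and leaves twice the count.
  This serves vectors \<open>(x, y)\<close> not yet known to be codewords.\<close>

lemma even_N11_if_orthogonal:
  assumes "v \<in> carrier_vec \<alpha>" "x \<in> carrier_vec \<alpha>" "w \<in> carrier_vec \<beta>" "y \<in> carrier_vec \<beta>"
    and "Z2Z4_inner (theta (v, w)) (theta (x, y)) = 0"
  shows "even (N11 w y)"
proof -
  have "2 * (of_nat (N11 w y) + 2 * of_bit (u_part (Z2R_inner (v, w) (x, y))) :: 4) = 0"
    using assms(5) unfolding Z2Z4_inner_theta[OF assms(1-4)] by simp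
  then have "(of_nat (2 * N11 w y) :: 4) = 0"
    by (cases "u_part (Z2R_inner (v, w) (x, y))") (simp_all add: distrib_left four_eq_0)
  then show ?thesis
    unfolding of_nat_4_eq_0_iff by presburger
qed

section \<open>Additivity, and translation by multiples of \<open>u\<close>\<close>

lemma u_part_Z2R_inner_add_left:
  assumes "v \<in> carrier_vec \<alpha>" "v' \<in> carrier_vec \<alpha>" "x \<in> carrier_vec \<alpha>"
    and "w \<in> carrier_vec \<beta>" "w' \<in> carrier_vec \<beta>" "y \<in> carrier_vec \<beta>"
  shows "u_part (Z2R_inner (v + v', w + w') (x, y)) =
    u_part (Z2R_inner (v, w) (x, y)) + u_part (Z2R_inner (v', w') (x, y))"
  using assms
  by (simp add: u_part_Z2R_inner[of _ \<alpha> _ _ \<beta>] distrib_right u_part_add sum.distrib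
      add.assoc add.commute add.left_commute
      del: add_bit_eq_xor mult_bit_eq_and)

text \<open>The added vector is u times the lift of \<open>z\<close>; multiplying by u leaves only
  the residue of each \<open>w $ i\<close>.\<close>

lemma u_part_Z2R_inner_add_right:
  assumes "v \<in> carrier_vec \<alpha>" "x \<in> carrier_vec \<alpha>"
    and "w \<in> carrier_vec \<beta>" "y \<in> carrier_vec \<beta>"
  shows "u_part (Z2R_inner (v, w) (x, y + vec \<beta> (Z2u 0 \<circ> z))) =
    u_part (Z2R_inner (v, w) (x, y)) + (\<Sum>i<\<beta>. z i * eta (w $ i))"
  using assms
  by (simp add: u_part_Z2R_inner[of _ \<alpha> _ _ \<beta>] distrib_left u_part_add u_part_mult sum.distrib
      ac_simps del: add_bit_eq_xor mult_bit_eq_and)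

lemma N11_add_u_right:
  assumes "w \<in> carrier_vec \<beta>" "y \<in> carrier_vec \<beta>"
  shows "N11 w (y + vec \<beta> (Z2u 0 \<circ> z)) = N11 w y"
  unfolding N11_def using assms
  by (intro arg_cong[where f = card]) (auto simp: z2u_unit_iff_eta eta_hom(1))

section \<open>Surjectivity of \<open>theta\<close>\<close>

lemma theta_elem_surj: "\<exists>a. theta_elem a = t"
proof -
  obtain k where k: "t = of_int k" "0 \<le> k" "k < 4"
    by (cases t) auto
  then have "k \<in> {0, 1, 2, 3}" by auto
  then show ?thesis using theta_elem_values k(1) by auto
qed

lemma theta_surj:
  assumes "p \<in> carrier_vec \<alpha> \<times> carrier_vec \<beta>"
  obtains x y where "x \<in> carrier_vec \<alpha>" "y \<in> carrier_vec \<beta>" "p = theta (x, y)"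
proof -
  obtain x t where p: "p = (x, t)" "x \<in> carrier_vec \<alpha>" "t \<in> carrier_vec \<beta>"
    using assms by auto
  obtain a where "\<And>t. theta_elem (a t) = t"
    using theta_elem_surj by metis
  then have "p = theta (x, map_vec a t)"
    by (auto simp: theta_def p(1))
  moreover have "map_vec a t \<in> carrier_vec \<beta>" using p(3) by simp
  ultimately show thesis using that p(2) by blast
qed

section \<open>Self-orthogonality and self-duality of the image\<close>

context
  fixes \<alpha> \<beta> :: nat and C :: "(bit vec \<times> z2u vec) set"
  assumes code: "Z2R_linear_code \<alpha> \<beta> C"
    and N11_dvd: "\<And>v w x y. (v, w) \<in> C \<Longrightarrow> (x, y) \<in> C \<Longrightarrow> 4 dvd N11 w y"
begin

lemma code_carrier: "(v, w) \<in> C \<Longrightarrow> v \<in> carrier_vec \<alpha> \<and> w \<in> carrier_vec \<beta>"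
  using code
  by (auto simp: Z2R_linear_code_def Z2R_module_def submodule_def dest!: subgroup.subset)

lemma code_add: "(v, w) \<in> C \<Longrightarrow> (v', w') \<in> C \<Longrightarrow> (v + v', w + w') \<in> C"
  using code subgroup.m_closed[of C "add_monoid (Z2R_module \<alpha> \<beta>)" "(v, w)" "(v', w')"]
  by (auto simp: Z2R_linear_code_def Z2R_module_def submodule_def)

lemma theta_self_orthogonal:
  assumes "Z2R_self_orthogonal \<alpha> \<beta> C"
  shows "Z2Z4_self_orthogonal \<alpha> \<beta> (theta ` C)"
proof -
  have "theta (x, y) \<in> Z2Z4_dual \<alpha> \<beta> (theta ` C)" if p: "(x, y) \<in> C" for x y
  proof -
    have "Z2Z4_inner (theta (v, w)) (theta (x, y)) = 0" if c: "(v, w) \<in> C" for v w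
    proof -
      have "Z2R_inner (v, w) (x, y) = 0"
        using assms p c by (auto simp: Z2R_self_orthogonal_def Z2R_dual_def)
      then show ?thesis
        using Z2Z4_inner_theta_eq_0_iff code_carrier[OF p] code_carrier[OF c] N11_dvd[OF c p]
        by blast
    qed
    then show ?thesis
      using code_carrier[OF p] by (auto simp: Z2Z4_dual_def theta_def)
  qed
  then show ?thesis by (auto simp: Z2Z4_self_orthogonal_def)
qed

lemma theta_self_dual:
  assumes self_dual: "Z2R_self_dual \<alpha> \<beta> C"
  shows "Z2Z4_self_dual \<alpha> \<beta> (theta ` C)"
proof -
  have in_code: "(x, y) \<in> C"
    if "x \<in> carrier_vec \<alpha>" "y \<in> carrier_vec \<beta>"
      "\<And>v w. (v, w) \<in> C \<Longrightarrow> Z2R_inner (v, w) (x, y) = 0" for x y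
    using self_dual that unfolding Z2R_self_dual_def Z2R_dual_def by auto
  have "p \<in> theta ` C" if p: "p \<in> Z2Z4_dual \<alpha> \<beta> (theta ` C)" for p
  proof -
    obtain x y where x: "x \<in> carrier_vec \<alpha>" and y: "y \<in> carrier_vec \<beta>" and p_eq: "p = theta (x, y)"
      using p theta_surj[of p \<alpha> \<beta>] by (auto simp: Z2Z4_dual_def)
    have orth: "Z2Z4_inner (theta (v, w)) (theta (x, y)) = 0" if "(v, w) \<in> C" for v w
      using p that by (auto simp: Z2Z4_dual_def p_eq)
    let ?add = "\<lambda>c d. (fst c + fst d, snd c + snd d)"
    let ?mu = "\<lambda>c. u_part (Z2R_inner c (x, y))"
    have "\<exists>z. \<forall>c\<in>C. ?mu c = (\<Sum>i<\<beta>. z i * eta (snd c $ i))"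
    proof (rule bit_functional_in_span[where f = ?add])
      show "?add c d \<in> C" if "c \<in> C" "d \<in> C" for c d
        using that by (auto intro: code_add)
      show "eta (snd (?add c d) $ i) =
        eta (snd c $ i) + eta (snd d $ i)" if "i < \<beta>" "c \<in> C" "d \<in> C" for i c d
        using that code_carrier
        by (cases c; cases d) (fastforce simp: eta_hom(1) simp del: add_bit_eq_xor)
      show "?mu (?add c d) = ?mu c + ?mu d"
        if "c \<in> C" "d \<in> C" for c d
        using that code_carrier x y
        by (cases c; cases d) (simp add: u_part_Z2R_inner_add_left[of _ \<alpha> _ _ _ \<beta>] del: add_bit_eq_xor)
      show "?mu c = 0" if "c \<in> C" "\<And>i. i < \<beta> \<Longrightarrow> eta (snd c $ i) = 0" for c
      proof -
        obtain v w where c: "c = (v, w)" by fastforce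
        then have vw: "v \<in> carrier_vec \<alpha>" "w \<in> carrier_vec \<beta>"
          using code_carrier that(1) by auto
        \<comment> \<open>A word \<open>w\<close> without unit coordinates meets any
          \<open>y\<close> in no unit pair, so the divisibility holds although \<open>(x, y)\<close>
          is not known to be a codeword.\<close>
        have "N11 w y = 0"
          using that(2) vw by (auto simp: N11_def c z2u_unit_iff_eta)
        then have "Z2R_inner c (x, y) = 0"
          using Z2Z4_inner_theta_eq_0_iff[OF vw(1) x vw(2) y] orth that(1) by (simp add: c)
        then show ?thesis by (simp add: zero_z2u_def)
      qed
    qed
    then obtain z where z: "\<And>v w. (v, w) \<in> C \<Longrightarrow> ?mu (v, w) = (\<Sum>i<\<beta>. z i * eta (w $ i))"
      by (metis snd_conv)
    \<comment> \<open>The translation adds \<open>?mu\<close> to a \<open>u\<close>-part already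
      equal to \<open>?mu\<close>, and the two cancel in \<open>bit\<close>.\<close>
    let ?y = "y + vec \<beta> (Z2u 0 \<circ> z)"
    have y': "?y \<in> carrier_vec \<beta>" using y by simp
    have "(x, ?y) \<in> C"
    proof (rule in_code[OF x y'])
      fix v w assume c: "(v, w) \<in> C"
      then have vw: "v \<in> carrier_vec \<alpha>" "w \<in> carrier_vec \<beta>"
        using code_carrier by auto
      \<comment> \<open>The residue depends only on the parity of the count, which the translation
        preserves.\<close>
      have "eta (Z2R_inner (v, w) (x, ?y)) = 0"
        using even_N11_if_orthogonal[OF vw(1) x vw(2) y orth[OF c]]
        by (simp only: eta_Z2R_inner_eq_0_iff[OF vw(2) y'] N11_add_u_right[OF vw(2) y])
      moreover have "u_part (Z2R_inner (v, w) (x, ?y)) = 0"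
        unfolding u_part_Z2R_inner_add_right[OF vw(1) x vw(2) y] z[OF c] by simp
      ultimately show "Z2R_inner (v, w) (x, ?y) = 0"
        by (cases "Z2R_inner (v, w) (x, ?y)") (simp add: zero_z2u_def)
    qed
    have "(x, y) \<in> C"
    proof (rule in_code[OF x y])
      fix v w assume c: "(v, w) \<in> C"
      then have vw: "v \<in> carrier_vec \<alpha>" "w \<in> carrier_vec \<beta>"
        using code_carrier by auto
      have "4 dvd N11 w y"
        using N11_dvd[OF c \<open>(x, ?y) \<in> C\<close>] N11_add_u_right[OF vw(2) y] by simp
      then show "Z2R_inner (v, w) (x, y) = 0"
        using Z2Z4_inner_theta_eq_0_iff[OF vw(1) x vw(2) y] orth[OF c] by simp
    qed
    then show ?thesis by (simp add: p_eq)
  qed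
  moreover have "Z2R_self_orthogonal \<alpha> \<beta> C"
    using self_dual by (simp add: Z2R_self_dual_def Z2R_self_orthogonal_def)
  then have "theta ` C \<subseteq> Z2Z4_dual \<alpha> \<beta> (theta ` C)"
    using theta_self_orthogonal by (simp add: Z2Z4_self_orthogonal_def)
  ultimately show ?thesis by (auto simp: Z2Z4_self_dual_def)
qed

end

theorem theorem3p3:
  fixes \<alpha> \<beta> :: nat and C :: "(bit vec \<times> z2u vec) set"
  assumes "Z2R_linear_code \<alpha> \<beta> C"
    and "\<And>v w x y. (v, w) \<in> C \<Longrightarrow> (x, y) \<in> C \<Longrightarrow> 4 dvd N11 w y"
  shows "(Z2R_self_orthogonal \<alpha> \<beta> C \<longrightarrow> Z2Z4_self_orthogonal \<alpha> \<beta> (theta ` C)) \<and>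
    (Z2R_self_dual \<alpha> \<beta> C \<longrightarrow> Z2Z4_self_dual \<alpha> \<beta> (theta ` C))"
  by (blast intro: theta_self_orthogonal[OF assms(1)] theta_self_dual[OF assms(1)] assms(2))

end
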